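(* If $G$ is a finite simple graph without isolated vertices, then $B(G)\leq Z(L(G))$, where $B$ denotes the brushing number, $Z$ the zero forcing number, and $L(G)$ the line graph of $G$.
   Context: All graphs are non-empty, simple, finite and undirected; $[k]=\{1,\ldots,k\}$. The zero forcing number $Z(G)$ of a graph $G$ with $n$ vertices is the minimum positive integer $k$ for which there are $k$ vertices $u_1,\ldots,u_k$ of $G$ and a linear order $u_{k+1},\ldots,u_n$ of the remaining vertices such that for every $j\in\{k+1,\ldots,n\}$ there is some $i\in[j-1]$ such that $u_j$ is the unique neighbor of $u_i$ in $G$ contained in $\{u_j,u_{j+1},\ldots,u_n\}$ (one says $u_i$ forces $u_j$). The brushing number $B(G)$ is the minimum positive integer $k$ for which there is an acyclic orientation $\vec{G}$ of $G$ and $k$ directed paths in $\vec{G}$ such that every directed edge of $\vec{G}$ belongs to at least one of these paths. The line graph $L(G)$ has vertex set $E(G)$, two vertices being adjacent iff the corresponding edges of $G$ share an endpoint. *)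

theory Defs
  imports "Graph_Theory.Graph_Theory"
begin

text \<open>
  Finite simple undirected graphs are modelled by the locale \<open>pair_graph\<close>: finite, loop-free
  digraphs whose arc relation is symmetric, so that the undirected edge \<open>uv\<close> is the pair of
  arcs \<open>(u, v)\<close> and \<open>(v, u)\<close>.
\<close>

definition edges :: "'a pair_pre_digraph \<Rightarrow> 'a set set" where
  "edges G = {{u, v} | u v. (u, v) \<in> parcs G}"

definition line_graph :: "'a pair_pre_digraph \<Rightarrow> 'a set pair_pre_digraph" where
  "line_graph G =
     \<lparr> pverts = edges G,
       parcs = {(e, f). e \<in> edges G \<and> f \<in> edges G \<and> e \<noteq> f \<and> e \<inter> f \<noteq> {}} \<rparr>"

text \<open>
  Lists are indexed from 0, so the vertices \<open>us ! 0, \<dots>, us ! (k - 1)\<close>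
  are the initial ones.
\<close>
definition zero_forcing_order :: "'a pair_pre_digraph \<Rightarrow> nat \<Rightarrow> 'a list \<Rightarrow> bool" where
  "zero_forcing_order G k us \<longleftrightarrow>
     distinct us \<and> set us = pverts G \<and> k \<le> length us \<and>
     (\<forall>j. k \<le> j \<and> j < length us \<longrightarrow>
        (\<exists>i<j. {w \<in> set (drop j us). (us ! i, w) \<in> parcs G} = {us ! j}))"

definition zero_forcing_number :: "'a pair_pre_digraph \<Rightarrow> nat" where
  "zero_forcing_number G = (LEAST k. 0 < k \<and> (\<exists>us. zero_forcing_order G k us))"

definition acyclic_orientation :: "'a pair_pre_digraph \<Rightarrow> 'a pair_pre_digraph \<Rightarrow> bool" where
  "acyclic_orientation G H \<longleftrightarrow>
     pverts H = pverts G \<and>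
     parcs H \<union> (parcs H)\<inverse> = parcs G \<and>
     parcs H \<inter> (parcs H)\<inverse> = {} \<and>
     acyclic (parcs H)"

text \<open>A directed path is given by its list of arcs, so \<open>set p\<close> is the set of arcs on it.\<close>
definition path_cover :: "'a pair_pre_digraph \<Rightarrow> ('a \<times> 'a) list list \<Rightarrow> bool" where
  "path_cover H ps \<longleftrightarrow>
     (\<forall>p \<in> set ps. \<exists>u v. pre_digraph.apath (with_proj H) u p v) \<and>
     (\<forall>a \<in> parcs H. \<exists>p \<in> set ps. a \<in> set p)"

definition brushing_number :: "'a pair_pre_digraph \<Rightarrow> nat" where
  "brushing_number G =
     (LEAST k. 0 < k \<and> (\<exists>H ps. acyclic_orientation G H \<and> path_cover H ps \<and> length ps = k))"

text \<open>
  The line graph is again a finite simple graph, and both minima range over non-empty sets.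
\<close>

lemma pair_graph_line_graph:
  assumes "pair_graph G"
  shows "pair_graph (line_graph G)"
proof -
  interpret pair_graph G by fact
  have "edges G = (\<lambda>(u, v). {u, v}) ` parcs G"
    by (auto simp: edges_def)
  then have fin: "finite (edges G)"
    by simp
  have "parcs (line_graph G) \<subseteq> edges G \<times> edges G"
    by (auto simp: line_graph_def)
  then have fin': "finite (parcs (line_graph G))"
    using fin finite_subset by blast
  have "symmetric (with_proj (line_graph G))"
    by (auto simp: symmetric_def line_graph_def sym_def)
  with fin fin' show ?thesis
    by unfold_locales (auto simp: line_graph_def)
qed

lemma zero_forcing_order_exists:
  assumes "pair_graph G" "pverts G \<noteq> {}"
  shows "\<exists>k us. 0 < k \<and> zero_forcing_order G k us"
proof -
  interpret pair_graph G by fact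
  obtain us where "distinct us" "set us = pverts G"
    using finite_distinct_list[OF pair_finite_verts] by blast
  then have "zero_forcing_order G (length us) us" "0 < length us"
    using assms(2) by (auto simp: zero_forcing_order_def)
  then show ?thesis by blast
qed

lemma brushing_exists:
  assumes "pair_graph G" "pverts G \<noteq> {}"
  shows "\<exists>k H ps. 0 < k \<and> acyclic_orientation G H \<and> path_cover H ps \<and> length ps = k"
proof -
  interpret pair_graph G by fact
  obtain f :: "'a \<Rightarrow> nat" where f: "inj_on f (pverts G)"
    using finite_imp_inj_to_nat_seg[OF pair_finite_verts] by blast
  define A where "A = {(u, v) \<in> parcs G. f u < f v}"
  define H where "H = \<lparr> pverts = pverts G, parcs = A \<rparr>"
  have sym: "(u, v) \<in> parcs G \<Longrightarrow> (v, u) \<in> parcs G" for u v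
    using pair_sym_arcs by (auto simp: symmetric_def sym_def)
  have tot: "(u, v) \<in> parcs G \<Longrightarrow> f u < f v \<or> f v < f u" for u v
    using f pair_no_loops[of "(u, v)"] arc_fst_in_verts[of "(u, v)"] arc_snd_in_verts[of "(u, v)"]
    by (auto simp: inj_on_def) (metis linorder_neqE_nat)
  have "A \<subseteq> measure f"
    by (auto simp: A_def)
  then have "acyclic A"
    by (meson wf_measure wf_acyclic acyclic_subset)
  then have ori: "acyclic_orientation G H"
    using sym tot by (auto simp: acyclic_orientation_def H_def A_def)
  have "A \<subseteq> parcs G" by (auto simp: A_def)
  then have "finite A"
    using pair_finite_arcs finite_subset by blast
  then obtain as where as: "set as = A"
    using finite_list by blast
  obtain x where x: "x \<in> pverts G" using assms(2) by blast
  define ps where "ps = [] # map (\<lambda>a. [a]) as"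
  interpret H: pair_wf_digraph H
    by unfold_locales (auto simp: H_def A_def dest: arc_fst_in_verts arc_snd_in_verts)
  have H: "pverts H = pverts G" "parcs H = A"
    by (simp_all add: H_def)
  have "\<exists>u v. H.apath u p v" if p_in: "p \<in> set ps" for p
  proof (cases "p = []")
    case True
    then show ?thesis
      using x by (auto simp: H.apath_Nil_iff H)
  next
    case False
    then obtain u v where p: "p = [(u, v)]" and uv: "(u, v) \<in> A"
      using p_in as by (auto simp: ps_def)
    have "u \<noteq> v" using uv by (auto simp: A_def)
    moreover have "v \<in> pverts H"
      using uv arc_snd_in_verts[of "(u, v)"] by (auto simp: A_def H)
    ultimately have "H.apath u p v"
      using uv by (simp add: p H.apath_Cons_iff H.apath_Nil_iff H)
    then show ?thesis by blast
  qed
  moreover have "\<exists>p \<in> set ps. a \<in> set p" if "a \<in> parcs H" for a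
    using that as by (auto simp: ps_def H)
  ultimately have "path_cover H ps"
    by (simp add: path_cover_def)
  moreover have "0 < length ps" by (simp add: ps_def)
  ultimately show ?thesis using ori by blast
qed

end

theory Submission
  imports Defs
begin

text \<open>
  Let \<open>us\<close> be a zero forcing order of the line graph and let \<open>t v\<close> be the position of the last edge
  at \<open>v\<close>. If the edge \<open>uv\<close> forces the edge \<open>vw\<close> at position \<open>j\<close>, then no edge at \<open>u\<close> or \<open>v\<close> other
  than \<open>vw\<close> comes at position \<open>j\<close> or later, whence \<open>t u < t v = j \<le> t w\<close>. Orient every edge
  towards the larger value of \<open>t\<close>. A tie \<open>t x = t y = j\<close> along an edge \<open>xy\<close> means that \<open>xy\<close> is
  itself the edge at position \<open>j\<close>; it is directed away from the vertex through which it was forced.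
  The orientation is acyclic, the forcing chains follow it, and there is one chain per initial edge.
\<close>

text \<open>A chain through \<open>f i\<close> either ends there and can be extended by
  \<open>f m\<close>, or continues, and then uniqueness of \<open>P\<close>-successors makes
  \<open>f m\<close> its next element. Either way the number of chains stays \<open>k\<close>,
  starting from \<open>k\<close> singletons.\<close>

lemma chain_cover:
  assumes succ_unique: "\<And>a b c. P a b \<Longrightarrow> P a c \<Longrightarrow> b = c"
    and "k \<le> m"
    and "\<And>j. k \<le> j \<Longrightarrow> j < m \<Longrightarrow> \<exists>i<j. P (f i) (f j)"
  shows "\<exists>ps. length ps = k \<and>
           (\<forall>p \<in> set ps. p \<noteq> [] \<and> successively P p \<and> set p \<subseteq> f ` {..<m}) \<and>
           f ` {..<m} \<subseteq> (\<Union>p \<in> set ps. set p)"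
  using assms(2,3)
proof (induction m rule: dec_induct)
  case base
  show ?case
    by (rule exI[of _ "map (\<lambda>i. [f i]) [0..<k]"]) auto
next
  case (step m)
  then obtain ps where len: "length ps = k"
    and ps: "\<And>p. p \<in> set ps \<Longrightarrow> p \<noteq> [] \<and> successively P p \<and> set p \<subseteq> f ` {..<m}"
    and cov: "f ` {..<m} \<subseteq> (\<Union>p \<in> set ps. set p)"
    by (metis less_Suc_eq)
  obtain i where "i < m" and P: "P (f i) (f m)"
    using step.prems step.hyps by blast
  then obtain p where p: "p \<in> set ps" "f i \<in> set p"
    using cov by blast
  then obtain xs ys where split: "p = xs @ f i # ys"
    by (meson split_list)
  show ?case
  proof (cases ys)
    case (Cons y zs)
    have "P (f i) y"
      using ps[OF p(1)] by (auto simp: split Cons successively_append_iff)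
    then have "f m \<in> set p"
      using succ_unique[OF P] by (simp add: split Cons)
    then have "f ` {..<Suc m} \<subseteq> (\<Union>p \<in> set ps. set p)"
      using cov p(1) by (auto simp: lessThan_Suc)
    moreover have "\<forall>p \<in> set ps. p \<noteq> [] \<and> successively P p \<and> set p \<subseteq> f ` {..<Suc m}"
      using ps by (fastforce simp: lessThan_Suc)
    ultimately show ?thesis
      using len by blast
  next
    case Nil
    obtain q where q: "q < length ps" "ps ! q = p"
      using p(1) by (meson in_set_conv_nth)
    define qs where "qs = ps[q := p @ [f m]]"
    have "successively P (p @ [f m])" "set (p @ [f m]) \<subseteq> f ` {..<Suc m}"
      using ps[OF p(1)] P by (auto simp: split Nil successively_append_iff lessThan_Suc)
    moreover have "set qs \<subseteq> insert (p @ [f m]) (set ps)"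
      by (simp add: qs_def set_update_subset_insert)
    ultimately have "\<forall>p \<in> set qs. p \<noteq> [] \<and> successively P p \<and> set p \<subseteq> f ` {..<Suc m}"
      using ps by (fastforce simp: lessThan_Suc)
    moreover have "f ` {..<Suc m} \<subseteq> (\<Union>p \<in> set qs. set p)"
    proof -
      have ext: "p @ [f m] \<in> set qs"
        using q by (simp add: qs_def set_update_memI)
      \<comment> \<open>The update can remove only \<open>p\<close> from the list, and the elements
        of \<open>p\<close> all lie in its extension.\<close>
      have "\<exists>p' \<in> set qs. set r \<subseteq> set p'" if "r \<in> set ps" for r
      proof (cases "r = p")
        case True
        then show ?thesis by (intro bexI[OF _ ext]) auto
      next
        case False
        then have "r \<in> set qs"
          using that q by (metis in_set_conv_nth length_list_update nth_list_update_neq qs_def)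
        then show ?thesis by blast
      qed
      then have "(\<Union>p \<in> set ps. set p) \<subseteq> (\<Union>p \<in> set qs. set p)"
        by (intro UN_least) (meson UN_upper subset_trans)
      with cov have "f ` {..<m} \<subseteq> (\<Union>p \<in> set qs. set p)"
        by (rule subset_trans)
      moreover have "f m \<in> (\<Union>p \<in> set qs. set p)"
        by (rule UN_I[OF ext]) simp
      ultimately show ?thesis
        by (simp add: lessThan_Suc)
    qed
    moreover have "length qs = k"
      by (simp add: qs_def len)
    ultimately show ?thesis by blast
  qed
qed

text \<open>Since \<open>r\<close> grows along every arc, a walk cannot return to a vertex. The
  lower bound on \<open>r\<close> strengthens the induction: it keeps a new start vertex, of smaller
  rank, off the rest of the walk.\<close>

lemma (in pair_wf_digraph) apath_if_increasing:
  fixes r :: "'a \<Rightarrow> nat"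
  assumes "\<And>u v. (u, v) \<in> parcs G \<Longrightarrow> r u < r v"
    and "p \<noteq> []" "successively (\<lambda>a b. snd a = fst b) p" "set p \<subseteq> parcs G"
  shows "\<exists>v. apath (fst (hd p)) p v \<and> (\<forall>y \<in> set (awalk_verts (fst (hd p)) p). r (fst (hd p)) \<le> r y)"
  using assms(2-4)
proof (induction p rule: induct_list012)
  case (2 a)
  obtain u v where a: "a = (u, v)" by (cases a)
  with 2 assms(1) have "(u, v) \<in> parcs G" "r u < r v" by auto
  then show ?case
    using arc_snd_in_verts[of "(u, v)"]
    by (auto simp: a apath_Cons_iff apath_Nil_iff intro!: exI[of _ v])
next
  case (3 a b p)
  obtain u v where a: "a = (u, v)" by (cases a)
  have uv: "(u, v) \<in> parcs G" "fst b = v" using 3 by (auto simp: a)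
  then have lt: "r u < r v" using assms(1) by blast
  obtain x where x: "apath v (b # p) x" "\<And>y. y \<in> set (awalk_verts v (b # p)) \<Longrightarrow> r v \<le> r y"
    using 3 uv by (auto simp del: awalk_verts.simps)
  have "u \<notin> set (awalk_verts v (b # p))"
    using x(2)[of u] lt by auto
  then have "apath u (a # b # p) x"
    using x(1) uv by (simp add: apath_Cons_iff[of u "(u, v)"] a del: awalk_verts.simps)
  moreover have "r u \<le> r y" if "y \<in> set (awalk_verts u (a # b # p))" for y
    using that x(2)[of y] lt by (auto simp: a)
  ultimately show ?case by (auto simp: a simp del: awalk_verts.simps)
qed simp

text \<open>An edge after position \<open>j\<close> that meets \<open>{u, v}\<close> would be a
  second neighbor of \<open>us ! i\<close> among the edges from position \<open>j\<close> on,
  against the uniqueness required of a force.\<close>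

lemma line_graph_force:
  assumes G: "pair_graph G"
    and ord: "zero_forcing_order (line_graph G) k us"
    and j: "k \<le> j" "j < length us"
  obtains i u v w where "i < j" "us ! i = {u, v}" "us ! j = {v, w}" "u \<noteq> v" "u \<noteq> w" "v \<noteq> w"
    and "\<And>l. j < l \<Longrightarrow> l < length us \<Longrightarrow> u \<notin> us ! l \<and> v \<notin> us ! l"
proof -
  interpret pair_graph G by fact
  have dist: "distinct us" and set_us: "set us = edges G"
    using ord by (auto simp: zero_forcing_order_def line_graph_def)
  obtain i where i: "i < j"
    and force: "{w \<in> set (drop j us). (us ! i, w) \<in> parcs (line_graph G)} = {us ! j}"
    using ord j by (auto simp: zero_forcing_order_def)
  have ends: "\<exists>x y. us ! l = {x, y} \<and> x \<noteq> y" if "l < length us" for l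
    using that set_us nth_mem[OF that] pair_no_loops by (fastforce simp: edges_def)
  have "us ! j \<in> {w \<in> set (drop j us). (us ! i, w) \<in> parcs (line_graph G)}"
    using force by simp
  then have adj: "us ! i \<noteq> us ! j" "us ! i \<inter> us ! j \<noteq> {}"
    by (auto simp: line_graph_def)
  obtain a b c d where ab: "us ! i = {a, b}" "a \<noteq> b" and cd: "us ! j = {c, d}" "c \<noteq> d"
    using ends[of i] ends[of j] i j by fastforce
  obtain u v w where uvw: "us ! i = {u, v}" "us ! j = {v, w}" "u \<noteq> v" "u \<noteq> w" "v \<noteq> w"
  proof -
    have "a = c \<or> a = d \<or> b = c \<or> b = d" using adj ab cd by auto
    then show thesis
      \<comment> \<open>One instance for each choice of the shared endpoint;
        \<open>u \<noteq> w\<close> because the two edges differ.\<close>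
      using that[of b a d] that[of b a c] that[of a b d] that[of a b c] adj(1) ab cd
      by (auto simp: insert_commute)
  qed
  have "u \<notin> us ! l \<and> v \<notin> us ! l" if l: "j < l" "l < length us" for l
  proof (rule ccontr)
    assume "\<not> ?thesis"
    then have "us ! i \<inter> us ! l \<noteq> {}" using uvw by auto
    moreover have "us ! i \<noteq> us ! l" "us ! j \<noteq> us ! l"
      using dist i l by (auto simp: nth_eq_iff_index_eq)
    moreover have "us ! l \<in> set (drop j us)"
      using l by (auto simp: in_set_conv_nth intro!: exI[of _ "l - j"])
    moreover have "us ! i \<in> edges G" "us ! l \<in> edges G"
      using l i set_us nth_mem[of i us] nth_mem[of l us] by auto
    ultimately have "us ! l \<in> {w \<in> set (drop j us). (us ! i, w) \<in> parcs (line_graph G)}"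
      by (auto simp: line_graph_def)
    then show False using force \<open>us ! j \<noteq> us ! l\<close> by auto
  qed
  then show thesis using that i uvw by blast
qed

lemma brushing_of_line_graph_forcing:
  assumes G: "pair_graph G"
    and ord: "zero_forcing_order (line_graph G) k us"
  shows "\<exists>H ps. acyclic_orientation G H \<and> path_cover H ps \<and> length ps = k"
proof -
  interpret pair_graph G by fact
  define m where "m = length us"
  have set_us: "set us = edges G" and k: "k \<le> m"
    using ord by (auto simp: zero_forcing_order_def line_graph_def m_def)
  have sym: "(u, v) \<in> parcs G \<Longrightarrow> (v, u) \<in> parcs G" for u v
    using pair_sym_arcs by (auto simp: symmetric_def sym_def)
  have arc_index: "\<exists>l<m. us ! l = {u, v}" if "(u, v) \<in> parcs G" for u v
  proof -
    have "{u, v} \<in> set us" using that set_us by (auto simp: edges_def)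
    then show ?thesis by (auto simp: in_set_conv_nth m_def)
  qed

  \<comment> \<open>Last positions and forcing vertices\<close>
  define t where "t v = Max {l. l < m \<and> v \<in> us ! l}" for v
  have t_ge: "l \<le> t v" if "l < m" "v \<in> us ! l" for l v
    unfolding t_def using that by (intro Max_ge) auto
  \<comment> \<open>The witness \<open>l\<close> is essential: \<open>Max\<close> is unspecified on
    the empty set, so \<open>t v\<close> has meaning only if \<open>v\<close> lies on an
    edge.\<close>
  have t_in: "t v < m \<and> v \<in> us ! t v" if "l < m" "v \<in> us ! l" for l v
  proof -
    have "t v \<in> {l. l < m \<and> v \<in> us ! l}"
      unfolding t_def using that by (intro Max_in) auto
    then show ?thesis by simp
  qed

  define forced where "forced j v i \<longleftrightarrow> i < j \<and>
    (\<exists>u w. us ! i = {u, v} \<and> us ! j = {v, w} \<and> v \<noteq> w \<and> t u < j \<and> t v = j)" for j v i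
  have ex_forced: "\<exists>v i. forced j v i" if j: "k \<le> j" "j < m" for j
  proof -
    obtain i u v w where *: "i < j" "us ! i = {u, v}" "us ! j = {v, w}" "u \<noteq> v" "u \<noteq> w" "v \<noteq> w"
      and last: "\<And>l. j < l \<Longrightarrow> l < length us \<Longrightarrow> u \<notin> us ! l \<and> v \<notin> us ! l"
      using line_graph_force[OF G ord j[unfolded m_def]] by metis
    have "t u < m" "u \<in> us ! t u" "t v < m" "v \<in> us ! t v" "j \<le> t v"
      using t_in[of i u] t_in[of j v] t_ge[of j v] * j by auto
    \<comment> \<open>\<open>t u = j\<close> is excluded because \<open>u\<close> does not lie on
      the edge \<open>vw\<close>, and positions beyond \<open>j\<close> are excluded by
      \<open>last\<close>.\<close>
    then have "t u < j" "t v = j"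
      using last[of "t u"] last[of "t v"] * by (auto simp: m_def intro: le_neq_implies_less)
        (metis insert_iff linorder_neqE_nat singletonD)
    then show ?thesis using * unfolding forced_def by blast
  qed

  \<comment> \<open>\<open>s j\<close> is to be the tail of the edge at position \<open>j\<close> in
    case of a tie. An initial edge need not be forced, so any endpoint serves for it.\<close>
  define s where "s j = (if k \<le> j then SOME v. \<exists>i. forced j v i else SOME v. v \<in> us ! j)" for j
  have s_forced: "\<exists>i. forced j (s j) i" if "k \<le> j" "j < m" for j
    using someI_ex[OF ex_forced[OF that]] that by (simp add: s_def)
  have s_in: "s j \<in> us ! j" if "j < m" "v \<in> us ! j" for j v
  proof (cases "k \<le> j")
    case True
    then show ?thesis using s_forced[OF True that(1)] by (auto simp: forced_def)
  next
    case False
    then show ?thesis using someI[of "\<lambda>v. v \<in> us ! j", OF that(2)] by (simp add: s_def)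
  qed

  \<comment> \<open>The second summand breaks ties in \<open>t\<close>.\<close>
  define r where "r v = 2 * t v + (if v = s (t v) then 0 else 1)" for v
  have r_less: "r u < r v" if "t u < t v" for u v
    using that by (simp add: r_def)
  have r_neq: "r u \<noteq> r v" if uv: "(u, v) \<in> parcs G" for u v
  proof
    \<comment> \<open>By parity, equal ranks give equal \<open>t\<close> and equal tie-breakers. The
      edge at the common last position contains both \<open>u\<close> and \<open>v\<close>, so it is
      \<open>uv\<close> itself, and \<open>s\<close> selects exactly one of its ends.\<close>
    assume "r u = r v"
    then have tt: "t u = t v" and ss: "u = s (t u) \<longleftrightarrow> v = s (t v)"
      by (auto simp: r_def split: if_splits) presburger+
    obtain l where l: "l < m" "us ! l = {u, v}" using arc_index[OF uv] by blast
    have "u \<noteq> v" using uv pair_no_loops by fastforce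
    have mem: "t u < m" "u \<in> us ! t u" "v \<in> us ! t u"
      using t_in[of l u] t_in[of l v] l tt by auto
    obtain a b where "us ! t u = {a, b}"
      using set_us mem(1) nth_mem[of "t u" us] by (auto simp: m_def edges_def)
    then have "us ! t u = {u, v}" using mem \<open>u \<noteq> v\<close> by auto
    then show False using s_in[OF mem(1,2)] ss tt \<open>u \<noteq> v\<close> by auto
  qed

  \<comment> \<open>The orientation by increasing rank\<close>
  define H where "H = \<lparr> pverts = pverts G, parcs = {(u, v) \<in> parcs G. r u < r v} \<rparr>"
  have "parcs H \<subseteq> measure r"
    by (auto simp: H_def)
  then have "acyclic (parcs H)"
    by (meson wf_measure wf_acyclic acyclic_subset)
  moreover have "parcs H \<union> (parcs H)\<inverse> = parcs G"
    using sym r_neq by (auto simp: H_def) (meson linorder_neqE_nat)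
  moreover have "parcs H \<inter> (parcs H)\<inverse> = {}"
    by (auto simp: H_def)
  moreover have "pverts H = pverts G"
    by (simp add: H_def)
  ultimately have ori: "acyclic_orientation G H"
    by (simp add: acyclic_orientation_def)
  interpret H: pair_wf_digraph H
    by unfold_locales (auto simp: H_def dest: arc_fst_in_verts arc_snd_in_verts)

  \<comment> \<open>Forcing chains as directed paths\<close>
  have "\<exists>a. a \<in> parcs H \<and> us ! l = {fst a, snd a}" if l: "l < m" for l
  proof -
    obtain u v where uv: "(u, v) \<in> parcs G" "us ! l = {u, v}"
      using set_us l nth_mem[of l us] by (auto simp: m_def edges_def)
    then consider "(u, v) \<in> parcs H" | "(v, u) \<in> parcs H"
      using sym r_neq[OF uv(1)] by (auto simp: H_def) (meson linorder_neqE_nat)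
    then show ?thesis using uv(2) by cases (auto simp: insert_commute)
  qed
  then obtain f where f: "\<And>l. l < m \<Longrightarrow> f l \<in> parcs H \<and> us ! l = {fst (f l), snd (f l)}"
    by metis
  have f_eq: "f l = (u, v)" if "l < m" "us ! l = {u, v}" "r u < r v" for l u v
    using f[OF that(1)] that by (cases "f l") (auto simp: H_def doubleton_eq_iff)

  \<comment> \<open>The successor has to be the arc of the last edge at the head of
    \<open>a\<close>, so it is determined by \<open>a\<close> alone, as \<open>chain_cover\<close>
    demands.\<close>
  define P where "P a b \<longleftrightarrow> snd a = fst b \<and> us ! t (snd a) = {fst b, snd b}"
    for a b :: "'a \<times> 'a"
  have succ: "b = c" if "P a b" "P a c" for a b c
    using that by (auto simp: P_def prod_eq_iff doubleton_eq_iff)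
  have force: "\<exists>i<j. P (f i) (f j)" if j: "k \<le> j" "j < m" for j
  proof -
    obtain i u w where *: "i < j" "us ! i = {u, s j}" "us ! j = {s j, w}" "s j \<noteq> w"
        "t u < j" "t (s j) = j"
      using s_forced[OF j] by (auto simp: forced_def)
    have "f i = (u, s j)"
      using * j by (intro f_eq r_less) auto
    moreover have "f j = (s j, w)"
    proof (intro f_eq)
      \<comment> \<open>Either \<open>t w\<close> exceeds \<open>j\<close>, or there is a tie at
        position \<open>j\<close>, which \<open>s j\<close> wins as the vertex of even rank.\<close>
      have "j \<le> t w" using t_ge[of j w] * j by auto
      then show "r (s j) < r w" using * by (cases "t w = j") (auto simp: r_def)
    qed (use * j in auto)
    ultimately show ?thesis
      using * by (auto simp: P_def)
  qed
  have "\<exists>ps. length ps = k \<and>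
          (\<forall>p \<in> set ps. p \<noteq> [] \<and> successively P p \<and> set p \<subseteq> f ` {..<m}) \<and>
          f ` {..<m} \<subseteq> (\<Union>p \<in> set ps. set p)"
    by (rule chain_cover[OF _ k]) (fact succ, fact force)
  then obtain ps where len: "length ps = k"
    and ps: "\<And>p. p \<in> set ps \<Longrightarrow> p \<noteq> [] \<and> successively P p \<and> set p \<subseteq> f ` {..<m}"
    and cov: "f ` {..<m} \<subseteq> (\<Union>p \<in> set ps. set p)"
    by blast
  have "\<exists>u v. H.apath u p v" if "p \<in> set ps" for p
  proof -
    have "successively (\<lambda>a b. snd a = fst b) p"
      using ps[OF that] successively_mono[of P p] by (auto simp: P_def)
    moreover have "set p \<subseteq> parcs H"
      using ps[OF that] f by blast
    ultimately show ?thesis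
      using H.apath_if_increasing[of r p] ps[OF that] by (auto simp: H_def)
  qed
  moreover have "\<exists>p \<in> set ps. a \<in> set p" if "a \<in> parcs H" for a
  proof -
    obtain u v where a: "a = (u, v)" by (cases a)
    with that have uv: "(u, v) \<in> parcs G" "r u < r v" by (auto simp: H_def)
    then obtain l where "l < m" "us ! l = {u, v}" using arc_index by blast
    then have "a \<in> f ` {..<m}" using f_eq uv a by force
    then show ?thesis using cov by blast
  qed
  ultimately have "path_cover H ps"
    by (simp add: path_cover_def)
  then show ?thesis using ori len by blast
qed

theorem theorem1:
  fixes G :: "'a pair_pre_digraph"
  assumes "pair_graph G"
    and "pverts G \<noteq> {}"
    and "\<forall>v \<in> pverts G. \<exists>w. (v, w) \<in> parcs G"
  shows "brushing_number G \<le> zero_forcing_number (line_graph G)"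
proof -
  let ?k = "zero_forcing_number (line_graph G)"
  \<comment> \<open>A vertex exists and lies on an edge, so the line graph is non-empty and the
    minimum \<open>?k\<close> is attained.\<close>
  have "pverts (line_graph G) \<noteq> {}"
    using assms(2,3) by (fastforce simp: line_graph_def edges_def)
  then have "\<exists>k. 0 < k \<and> (\<exists>us. zero_forcing_order (line_graph G) k us)"
    using zero_forcing_order_exists[OF pair_graph_line_graph[OF assms(1)]] by blast
  then have "0 < ?k \<and> (\<exists>us. zero_forcing_order (line_graph G) ?k us)"
    unfolding zero_forcing_number_def by (rule LeastI_ex)
  then show ?thesis
    unfolding brushing_number_def
    using brushing_of_line_graph_forcing[OF assms(1)] by (intro Least_le) blast
qed

end
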